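(* For every integer $n\geq 3$, we have $|A_{2n}(4312)|=|SHSYT(n+2,n,n-2)|$.
   Context: A permutation $\pi=\pi_1\pi_2\cdots\pi_m$ of $[m]=\{1,2,\ldots,m\}$ is alternating if $\pi_1<\pi_2>\pi_3<\pi_4>\cdots$. A permutation $\pi$ contains a pattern $\sigma=\sigma_1\cdots\sigma_k\in S_k$ if there are indices $i_1<i_2<\cdots<i_k$ such that $\pi_{i_1}\pi_{i_2}\cdots\pi_{i_k}$ is order isomorphic to $\sigma$, i.e. $\pi_{i_l}<\pi_{i_r}$ if and only if $\sigma_l<\sigma_r$ for all $l,r\in[k]$; otherwise $\pi$ avoids $\sigma$. $A_m(\sigma)$ denotes the set of alternating permutations of $[m]$ that avoid $\sigma$. For a partition $\lambda=(\lambda_1>\lambda_2>\cdots>\lambda_m>0)$ with distinct parts, the shifted Young diagram of shape $\lambda$ is the array of cells with $m$ rows, where row $i$ has $\lambda_i$ cells and each row is indented by one cell to the right with respect to the previous row (so row $i$ occupies columns $i,i+1,\ldots,i+\lambda_i-1$). A shifted standard Young tableau of shape $\lambda$ is a filling of this diagram with the numbers $1,2,\ldots,\lambda_1+\cdots+\lambda_m$, each used once, such that entries increase along each row and each column. $SHSYT(\lambda)$ denotes the set of shifted standard Young tableaux of shape $\lambda$. *)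

theory Defs
  imports "HOL-Library.FuncSet" "HOL-Combinatorics.Multiset_Permutations"
begin

text \<open>
  Permutations of \<open>{1..m}\<close> are given in one-line notation, as the lists in
  \<^term>\<open>permutations_of_set {1..m}\<close>. List positions are counted from 0, so the letter
  \<open>\<pi>\<^sub>i\<close> is \<open>p ! (i - 1)\<close>.
\<close>

text \<open>Starts with an ascent: in 0-based positions, the ascents are at the even ones.\<close>

definition alternating :: "nat list \<Rightarrow> bool" where
  "alternating p \<longleftrightarrow> (\<forall>i. Suc i < length p \<longrightarrow>
     (if even i then p ! i < p ! Suc i else p ! i > p ! Suc i))"

definition contains_pattern :: "nat list \<Rightarrow> nat list \<Rightarrow> bool" where
  "contains_pattern p \<sigma> \<longleftrightarrow>
     (\<exists>f. strict_mono_on {..<length \<sigma>} f \<and> f ` {..<length \<sigma>} \<subseteq> {..<length p} \<and>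
          (\<forall>l<length \<sigma>. \<forall>r<length \<sigma>. p ! f l < p ! f r \<longleftrightarrow> \<sigma> ! l < \<sigma> ! r))"

definition alternating_avoiding :: "nat \<Rightarrow> nat list \<Rightarrow> nat list set" where
  "alternating_avoiding m \<sigma> =
     {p \<in> permutations_of_set {1..m}. alternating p \<and> \<not> contains_pattern p \<sigma>}"

text \<open>
  A partition with distinct parts is its strictly decreasing list of positive parts. Cells are
  pairs (row, column), both counted from 1.
\<close>

definition shifted_diagram :: "nat list \<Rightarrow> (nat \<times> nat) set" where
  "shifted_diagram ls =
     {(i, j). 1 \<le> i \<and> i \<le> length ls \<and> i \<le> j \<and> j < i + ls ! (i - 1)}"

text \<open>
  Tableaux are extensional (that is, \<^const>\<open>undefined\<close> outside the diagram), so that each filling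
  is represented by exactly one function.
\<close>

definition SHSYT :: "nat list \<Rightarrow> (nat \<times> nat \<Rightarrow> nat) set" where
  "SHSYT ls =
     {T \<in> extensional (shifted_diagram ls).
        bij_betw T (shifted_diagram ls) {1..sum_list ls} \<and>
        (\<forall>i j j'. (i, j) \<in> shifted_diagram ls \<and> (i, j') \<in> shifted_diagram ls \<and> j < j'
           \<longrightarrow> T (i, j) < T (i, j')) \<and>
        (\<forall>i i' j. (i, j) \<in> shifted_diagram ls \<and> (i', j) \<in> shifted_diagram ls \<and> i < i'
           \<longrightarrow> T (i, j) < T (i', j))}"

end

theory Submission
  imports Defs Complex_Main
begin

text \<open>
  Both sides are equal to \<open>2 (3n)! / (n! (n+1)! (n+2)!)\<close>.

  Alternating words of even length are built from right to left, by putting two letters in front.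
  A new first letter can take part in a pattern 4312 only as its 4, so it is admissible as long as it
  does not exceed \<open>m\<close>, the smallest letter that is the 3 of an occurrence of 312. To keep track of
  \<open>m\<close>, one has to know when a new letter starts an occurrence of 312, that is, where the smallest
  top of an ascent lies. In general this is a further statistic. However, if the first letter is \<open>f\<close>
  and the word can be prolonged at all, then \<open>f < m\<close>, hence \<open>f\<close> starts no occurrence of 312, and
  the smallest ascent top, if there is any, is \<open>f + 1\<close> (\<open>asc_below_iff_first\<close>). So the pair \<open>(f, m)\<close> controls the
  whole growth: the prolongations that can be prolonged again have the statistics \<open>(a, c)\<close> with
  \<open>1 \<le> a \<le> f + 1\<close> and \<open>f + 3 \<le> c \<le> m + 2\<close>, each pair once (\<open>sum_extensible_Suc\<close>).

  The number \<open>H k f m\<close> of ways to prolong such a word by \<open>k + 1\<close> pairs therefore satisfies a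
  recursion by double sums. Equivalently, for \<open>k > 0\<close> its mixed difference in \<open>f\<close> and \<open>m\<close> is a value
  at \<open>k - 1\<close>, and it vanishes for \<open>m = f\<close> and for \<open>f = -1\<close>. Products of two binomial coefficients solve the difference
  equation, and a signed sum of six of them, indexed by the arrangements of \<open>2, 0, -2\<close>, satisfies
  both boundary conditions (\<open>sum_H\<close>). Its value at the empty word, which has \<open>f = 0\<close> and \<open>m = 1\<close>, is
  the number of avoiders of length \<open>2 (k + 1)\<close>.

  The shifted tableaux are counted by removing the cell with the largest entry
  (\<open>card_linear_extensions\<close>), which gives a recursion on the row lengths that is solved by Thrall's
  product formula (\<open>num_tableaux_closed\<close>).
\<close>

section \<open>A signed sum of trinomial coefficients\<close>

text \<open>
  The upper argument ranges over all reals and the lower one over all integers, so that Pascal's rule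
  and the trinomial identity below hold without side conditions.
\<close>

definition binom :: "real \<Rightarrow> int \<Rightarrow> real" where
  "binom x j = (if j < 0 then 0 else x gchoose nat j)"

lemma binom_pascal: "binom x j - binom (x - 1) j = binom (x - 1) (j - 1)"
proof (cases "j \<le> 0")
  case False
  then have "nat j = Suc (nat (j - 1))" by simp
  then show ?thesis
    using False gbinomial_Suc_Suc[of "x - 1" "nat (j - 1)"] by (simp add: binom_def)
qed (auto simp: binom_def)

text \<open>
  Both sides are the trinomial coefficient choosing disjoint sets of sizes \<open>i\<close> and \<open>j\<close> out of \<open>x\<close>.
\<close>

lemma binom_trinomial:
  "binom x i * binom (x - of_int i) j = binom x j * binom (x - of_int j) i"
proof (cases "i < 0 \<or> j < 0")
  case False
  define a b where "a = nat i" and "b = nat j"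
  have ij: "i = int a" "j = int b" using False by (simp_all add: a_def b_def)
  have "of_nat (a + b) gchoose a = (of_nat (a + b) gchoose b :: real)"
    using binomial_symmetric[of a "a + b"]
    by (simp only: binomial_gbinomial[symmetric]) simp
  then have "(x gchoose a) * (x - of_nat a gchoose b) = (x gchoose b) * (x - of_nat b gchoose a)"
    using gbinomial_trinomial_revision[of a "a + b" x]
      gbinomial_trinomial_revision[of b "a + b" x] by simp
  then show ?thesis by (simp add: binom_def ij)
qed (auto simp: binom_def)

lemma binom_symmetric: "binom (real n) j = binom (real n) (int n - j)"
proof (cases "j < 0 \<or> int n < j")
  case True
  then show ?thesis
    by (auto simp: binom_def simp flip: binomial_gbinomial)
next
  case False
  then have "nat (int n - j) = n - nat j" "nat j \<le> n" by auto
  then show ?thesis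
    using False binomial_symmetric[of "nat j" n]
    by (simp add: binom_def flip: binomial_gbinomial)
qed

text \<open>
  By Pascal's rule, each factor solves a difference equation in one variable: its difference in \<open>m\<close>
  (in \<open>f\<close>) is the same factor for \<open>k - 1\<close>, at \<open>m + 2\<close> (at \<open>f + 1\<close>). The indices \<open>i, j\<close> parametrise
  the solutions; \<open>i\<close> occurs in the second factor to make the product a trinomial coefficient for \<open>m = f\<close>.
\<close>

definition trinom :: "nat \<Rightarrow> int \<Rightarrow> int \<Rightarrow> real \<Rightarrow> real \<Rightarrow> real" where
  "trinom k i j f m =
    binom (m + 3 * real k + 1) (int k + i) * binom (f + 2 * real k + 1 - of_int i) (int k + j)"

text \<open>
  The signed sum of \<^const>\<open>trinom\<close> over the six arrangements of \<open>2, 0, -2\<close>, the first two entries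
  being the indices. This is a reflection-principle solution: each term satisfies the same difference
  equation (\<open>trinom_step\<close>), and the signs make the sum vanish on the walls \<open>m = f\<close> and, for \<open>k > 0\<close>,
  \<open>f = -1\<close>. For an \<open>extensible\<close> word (defined below) with statistics \<open>f\<close> and \<open>m\<close>, it is the number of
  ways to prolong the word by \<open>k + 1\<close> pairs of letters.
\<close>

definition H :: "nat \<Rightarrow> real \<Rightarrow> real \<Rightarrow> real" where
  "H k f m = trinom k 2 0 f m - trinom k 0 2 f m
           + trinom k 0 (-2) f m - trinom k (-2) 0 f m
           + trinom k (-2) 2 f m - trinom k 2 (-2) f m"

text \<open>
  On the wall \<open>m = f\<close> the product is a genuine trinomial coefficient, symmetric in its indices, so
  terms with exchanged indices cancel.
\<close>

lemma trinom_diagonal: "trinom k i j f f = trinom k j i f f"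
  using binom_trinomial[of "f + 3 * real k + 1" "int k + i" "int k + j"]
  by (simp add: trinom_def algebra_simps)

lemma H_diagonal: "H k f f = 0"
  using trinom_diagonal[of k 2 0 f] trinom_diagonal[of k 0 "-2" f] trinom_diagonal[of k 2 "-2" f]
  by (simp add: H_def)

text \<open>
  At \<open>f = -1\<close> the second factor is an ordinary binomial coefficient, whose symmetry exchanges the
  second and third of the three numbers \<open>i, j, - i - j\<close>.
\<close>

lemma trinom_boundary:
  assumes "i \<le> 2"
  shows "trinom (Suc k) i j (-1) m = trinom (Suc k) i (- i - j) (-1) m"
proof -
  define n where "n = nat (2 * (int k + 1) - i)"
  have n: "real n = - 1 + 2 * real (Suc k) + 1 - i" "int n = 2 * (int k + 1) - i"
    using assms by (simp_all add: n_def)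
  have "int n - (int (Suc k) + j) = int (Suc k) + (- i - j)" using n by simp
  then show ?thesis
    using binom_symmetric[of n "int (Suc k) + j"] unfolding trinom_def n(1) by metis
qed

lemma H_boundary: "H (Suc k) (-1) m = 0"
  using trinom_boundary[of 2 k 0 m] trinom_boundary[of 0 k 2 m] trinom_boundary[of "-2" k 0 m]
  by (simp add: H_def)

text \<open>
  The mixed difference of a product is the product of the differences, and each difference is one
  application of Pascal's rule.
\<close>

lemma trinom_step:
  "(trinom (Suc k) i j f m - trinom (Suc k) i j f (m - 1))
   - (trinom (Suc k) i j (f - 1) m - trinom (Suc k) i j (f - 1) (m - 1))
   = trinom k i j (f + 1) (m + 2)"
proof -
  have "binom (m + 3 * real (Suc k) + 1) (int (Suc k) + i)
      - binom (m - 1 + 3 * real (Suc k) + 1) (int (Suc k) + i)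
      = binom (m + 2 + 3 * real k + 1) (int k + i)" (is "?a - ?b = ?c")
    using binom_pascal[of "m + 3 * real (Suc k) + 1" "int (Suc k) + i"] by (simp add: algebra_simps)
  moreover have "binom (f + 2 * real (Suc k) + 1 - i) (int (Suc k) + j)
      - binom (f - 1 + 2 * real (Suc k) + 1 - i) (int (Suc k) + j)
      = binom (f + 1 + 2 * real k + 1 - of_int i) (int k + j)" (is "?d - ?e = ?g")
    using binom_pascal[of "f + 2 * real (Suc k) + 1 - i" "int (Suc k) + j"]
    by (simp add: algebra_simps)
  moreover have "(?a * ?d - ?b * ?d) - (?a * ?e - ?b * ?e) = (?a - ?b) * (?d - ?e)"
    by (simp add: algebra_simps)
  ultimately show ?thesis by (simp only: trinom_def)
qed

lemma H_step:
  "(H (Suc k) f m - H (Suc k) f (m - 1)) - (H (Suc k) (f - 1) m - H (Suc k) (f - 1) (m - 1))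
   = H k (f + 1) (m + 2)"
  unfolding H_def
  using trinom_step[of k 2 0 f m] trinom_step[of k 0 2 f m] trinom_step[of k 0 "-2" f m]
    trinom_step[of k "-2" 0 f m] trinom_step[of k "-2" 2 f m] trinom_step[of k 2 "-2" f m]
  by linarith

lemma sum_H_fst:
  "(\<Sum>a = 1..f + 1. H k (real a) (m + 2)) = H (Suc k) (real f) m - H (Suc k) (real f) (m - 1)"
proof (induction f)
  case 0
  show ?case using H_step[of k 0 m] by (simp add: H_boundary)
next
  case (Suc f)
  then show ?case using H_step[of k "real (Suc f)" m] by (simp add: algebra_simps)
qed

text \<open>
  Summing the difference equation over a rectangle leaves the boundary values, which are zero on the
  two walls. The index ranges are those of the statistics of the prolongations of a word.
\<close>

lemma sum_H:
  assumes "f \<le> m"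
  shows "(\<Sum>a = 1..f + 1. \<Sum>c = f + 3..m + 2. H k (real a) (real c)) = H (Suc k) (real f) (real m)"
  using assms
proof (induction m rule: dec_induct)
  case base
  show ?case by (simp add: H_diagonal)
next
  case (step m)
  have "(\<Sum>c = f + 3..Suc m + 2. H k (real a) (real c))
      = (\<Sum>c = f + 3..m + 2. H k (real a) (real c)) + H k (real a) (real (Suc m) + 2)" for a
    using step.hyps by (simp add: add.commute)
  then show ?case
    using step.IH sum_H_fst[of k "real (Suc m)" f] by (simp add: sum.distrib)
qed

lemma H_0: "H 0 (real f) (real m) = real m * (real m + 1) / 2 - real f * (real f + 1) / 2"
proof -
  have gchoose_2: "x gchoose 2 = x * (x - 1) / 2" for x :: real
    by (simp add: gbinomial_prod_rev numeral_2_eq_2)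
  show ?thesis by (simp add: H_def trinom_def binom_def gchoose_2 field_simps)
qed

text \<open>
  At the statistics \<open>0, 1\<close> of the empty word, the two binomial coefficients just fail to combine to
  a trinomial coefficient; this leaves the extra linear factor.
\<close>

lemma trinom_0_1:
  assumes "int k + i = int p" "int k + j = int q" "int k + 1 - i - j = int r"
  shows "trinom k i j 0 1 =
    fact (3 * k + 2) / (fact p * fact q * fact r * (2 * real k + 2 - of_int i))"
proof -
  have eqs: "3 * k + 2 = p + Suc (q + r)" "2 * real k + 2 - of_int i = real (Suc (q + r))"
    "2 * real k + 1 - of_int i = real (q + r)" "1 + 3 * real k + 1 = real (3 * k + 2)"
    using assms by auto
  have "trinom k i j 0 1 = real (3 * k + 2 choose p) * real (q + r choose q)"
    unfolding trinom_def assms add_0 eqs(3,4)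
    by (simp add: binom_def binomial_gbinomial del: of_nat_add of_nat_mult)
  then show ?thesis
    unfolding eqs(1,2) by (simp add: binomial_fact field_simps del: of_nat_Suc of_nat_add)
qed

lemma H_closed:
  assumes "k \<ge> 2"
  shows "H k 0 1 = 2 * fact (3 * k + 3) / (fact (k + 1) * fact (k + 2) * fact (k + 3))"
proof -
  \<comment> \<open>Every term is a polynomial in \<open>x\<close> times the common unit \<open>U\<close>.\<close>
  define x where "x = real k"
  define U :: real where "U = fact (3 * k + 2) / (fact (k + 1) * fact (k + 2) * fact (k + 3))"
  obtain r where k: "k = r + 2" using assms by (metis add.commute le_Suc_ex)
  have x: "real r = x - 2" "x \<ge> 2" using assms by (simp_all add: x_def k)
  define a :: real where "a = fact r"
  have f: "fact r = a" "fact (r + 1) = (x - 1) * a" "fact (r + 2) = x * (x - 1) * a"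
      "fact (r + 3) = (x + 1) * x * (x - 1) * a" "fact (r + 4) = (x + 2) * (x + 1) * x * (x - 1) * a"
      "fact (r + 5) = (x + 3) * (x + 2) * (x + 1) * x * (x - 1) * a"
    by (simp_all add: a_def eval_nat_numeral x) (simp_all add: add.commute)
  have U: "U = fact (3 * k + 2) / (fact (r + 3) * fact (r + 4) * fact (r + 5))"
    by (simp add: U_def k eval_nat_numeral)
  have a: "a \<noteq> 0" by (simp add: a_def)
  have T: "trinom k 2 0 0 1 = U * ((x + 1)\<^sup>2 * (x + 2) * (x + 3) / 2)"
      "trinom k 0 2 0 1 = U * (x * (x + 1) * (x + 2) * (x + 3) / 2)"
      "trinom k 0 (-2) 0 1 = U * ((x - 1) * x * (x + 1) * (x + 2) / 2)"
      "trinom k (-2) 0 0 1 = U * ((x - 1) * x * (x + 1)\<^sup>2 / 2)"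
      "trinom k (-2) 2 0 1 = U * ((x - 1) * x * (x + 1) * (x + 3) / 2)"
      "trinom k 2 (-2) 0 1 = U * ((x - 1) * (x + 1) * (x + 2) * (x + 3) / 2)"
    using a x(2)
      trinom_0_1[of k 2 "r + 4" 0 "r + 2" "r + 1"] trinom_0_1[of k 0 "r + 2" 2 "r + 4" "r + 1"]
      trinom_0_1[of k 0 "r + 2" "-2" r "r + 5"] trinom_0_1[of k "-2" r 0 "r + 2" "r + 5"]
      trinom_0_1[of k "-2" r 2 "r + 4" "r + 3"] trinom_0_1[of k 2 "r + 4" "-2" r "r + 3"]
    unfolding f U x_def[symmetric]
    by (simp_all add: k divide_simps power2_eq_square) (simp_all add: algebra_simps)
  have "fact (3 * k + 3) = 3 * (x + 1) * fact (3 * k + 2)" by (simp add: eval_nat_numeral x_def)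
  then have "2 * fact (3 * k + 3) / (fact (k + 1) * fact (k + 2) * fact (k + 3)) = U * (6 * (x + 1))"
    by (simp add: U_def)
  also have "\<dots> = H k 0 1"
    unfolding H_def T by (simp add: field_simps power2_eq_square)
  finally show ?thesis by simp
qed

section \<open>Words avoiding 4312 and their prolongations\<close>

text \<open>
  The three predicates describe the pattern 4312 one letter at a time, from its end: an ascent with
  top below \<open>t\<close>, an occurrence of 312 with largest letter below \<open>t\<close>, and an occurrence of 4312. Each
  is obtained from the previous one by letting the first letter of the word play the largest role.
\<close>

fun asc_below :: "nat \<Rightarrow> nat list \<Rightarrow> bool" where
  "asc_below t [] \<longleftrightarrow> False"
| "asc_below t (x # l) \<longleftrightarrow> asc_below t l \<or> (\<exists>y\<in>set l. x < y \<and> y < t)"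

fun has312_below :: "nat \<Rightarrow> nat list \<Rightarrow> bool" where
  "has312_below t [] \<longleftrightarrow> False"
| "has312_below t (x # l) \<longleftrightarrow> has312_below t l \<or> x < t \<and> asc_below x l"

fun has4312 :: "nat list \<Rightarrow> bool" where
  "has4312 [] \<longleftrightarrow> False"
| "has4312 (x # l) \<longleftrightarrow> has4312 l \<or> has312_below x l"

lemma asc_below_iff:
  "asc_below t l \<longleftrightarrow> (\<exists>i j. i < j \<and> j < length l \<and> l ! i < l ! j \<and> l ! j < t)"
proof (induction l)
  case (Cons x l)
  show ?case (is "_ \<longleftrightarrow> ?R")
  proof
    assume "asc_below t (x # l)"
    then consider i j where "i < j" "j < length l" "l ! i < l ! j" "l ! j < t"
      | j where "j < length l" "x < l ! j" "l ! j < t"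
      by (auto simp: Cons.IH in_set_conv_nth)
    then show ?R
    proof cases
      case (1 i j)
      then show ?thesis by (intro exI[of _ "Suc i"] exI[of _ "Suc j"]) simp
    next
      case (2 j)
      then show ?thesis by (intro exI[of _ 0] exI[of _ "Suc j"]) simp
    qed
  next
    assume ?R
    then obtain i j where *: "i < j" "j < length (x # l)" "(x # l) ! i < (x # l) ! j" "(x # l) ! j < t"
      by blast
    obtain j' where "j = Suc j'" using * by (cases j) auto
    then show "asc_below t (x # l)" using * by (cases i) (auto simp: Cons.IH)
  qed
qed simp

lemma has312_below_iff:
  "has312_below t l \<longleftrightarrow> (\<exists>i j k. i < j \<and> j < k \<and> k < length l \<and>
     l ! j < l ! k \<and> l ! k < l ! i \<and> l ! i < t)"
proof (induction l)
  case (Cons x l)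
  show ?case (is "_ \<longleftrightarrow> ?R")
  proof
    assume "has312_below t (x # l)"
    then consider i j k where "i < j" "j < k" "k < length l" "l ! j < l ! k" "l ! k < l ! i" "l ! i < t"
      | j k where "j < k" "k < length l" "l ! j < l ! k" "l ! k < x" "x < t"
      by (auto simp: Cons.IH asc_below_iff)
    then show ?R
    proof cases
      case (1 i j k)
      then show ?thesis by (intro exI[of _ "Suc i"] exI[of _ "Suc j"] exI[of _ "Suc k"]) simp
    next
      case (2 j k)
      then show ?thesis by (intro exI[of _ 0] exI[of _ "Suc j"] exI[of _ "Suc k"]) simp
    qed
  next
    assume ?R
    then obtain i j k where *: "i < j" "j < k" "k < length (x # l)" "(x # l) ! j < (x # l) ! k"
        "(x # l) ! k < (x # l) ! i" "(x # l) ! i < t"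
      by blast
    obtain j' k' where "j = Suc j'" "k = Suc k'" using * by (cases j; cases k) auto
    then show "has312_below t (x # l)"
      using * by (cases i) (auto simp: Cons.IH asc_below_iff)
  qed
qed simp

lemma has4312_iff:
  "has4312 l \<longleftrightarrow> (\<exists>h i j k. h < i \<and> i < j \<and> j < k \<and> k < length l \<and>
     l ! j < l ! k \<and> l ! k < l ! i \<and> l ! i < l ! h)"
proof (induction l)
  case (Cons x l)
  show ?case (is "_ \<longleftrightarrow> ?R")
  proof
    assume "has4312 (x # l)"
    then consider h i j k where "h < i" "i < j" "j < k" "k < length l"
        "l ! j < l ! k" "l ! k < l ! i" "l ! i < l ! h"
      | i j k where "i < j" "j < k" "k < length l" "l ! j < l ! k" "l ! k < l ! i" "l ! i < x"
      by (auto simp: Cons.IH has312_below_iff)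
    then show ?R
    proof cases
      case (1 h i j k)
      then show ?thesis
        by (intro exI[of _ "Suc h"] exI[of _ "Suc i"] exI[of _ "Suc j"] exI[of _ "Suc k"]) simp
    next
      case (2 i j k)
      then show ?thesis
        by (intro exI[of _ 0] exI[of _ "Suc i"] exI[of _ "Suc j"] exI[of _ "Suc k"]) simp
    qed
  next
    assume ?R
    then obtain h i j k where *: "h < i" "i < j" "j < k" "k < length (x # l)"
        "(x # l) ! j < (x # l) ! k" "(x # l) ! k < (x # l) ! i" "(x # l) ! i < (x # l) ! h"
      by blast
    obtain i' j' k' where "i = Suc i'" "j = Suc j'" "k = Suc k'"
      using * by (cases i; cases j; cases k) auto
    then show "has4312 (x # l)"
      using * by (cases h) (auto simp: Cons.IH has312_below_iff)
  qed
qed simp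

lemma contains_4312_iff: "contains_pattern p [4, 3, 1, 2] \<longleftrightarrow> has4312 p"
proof
  assume "contains_pattern p [4, 3, 1, 2]"
  then obtain f where f: "strict_mono_on {..<length [4, 3, 1, 2 :: nat]} f"
      "f ` {..<length [4, 3, 1, 2 :: nat]} \<subseteq> {..<length p}"
    and ord: "\<forall>l<length [4, 3, 1, 2 :: nat]. \<forall>r<length [4, 3, 1, 2 :: nat].
      p ! f l < p ! f r \<longleftrightarrow> [4, 3, 1, 2] ! l < ([4, 3, 1, 2] ! r :: nat)"
    unfolding contains_pattern_def by blast
  have "f 0 < f 1" "f 1 < f 2" "f 2 < f 3"
    by (rule strict_mono_onD[OF f(1)]; simp)+
  moreover have "f 3 < length p" using f(2) by (simp add: image_subset_iff)
  moreover have "p ! f 2 < p ! f 3" "p ! f 3 < p ! f 1" "p ! f 1 < p ! f 0"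
    using ord[rule_format, of 2 3] ord[rule_format, of 3 1] ord[rule_format, of 1 0] by simp_all
  ultimately show "has4312 p" unfolding has4312_iff by blast
next
  assume "has4312 p"
  then obtain h i j k where *: "h < i" "i < j" "j < k" "k < length p"
    "p ! j < p ! k" "p ! k < p ! i" "p ! i < p ! h"
    unfolding has4312_iff by blast
  have four: "{..<length [4, 3, 1, 2 :: nat]} = {0, 1, 2, 3}" by auto
  show "contains_pattern p [4, 3, 1, 2]"
    unfolding contains_pattern_def
  proof (intro exI[of _ "\<lambda>n. [h, i, j, k] ! n"] conjI)
    show "strict_mono_on {..<length [4, 3, 1, 2 :: nat]} (\<lambda>n. [h, i, j, k] ! n)"
      unfolding four using *(1-3) by (auto intro!: strict_mono_onI)
    show "(\<lambda>n. [h, i, j, k] ! n) ` {..<length [4, 3, 1, 2 :: nat]} \<subseteq> {..<length p}"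
      unfolding four using *(1-4) by simp
    have "\<forall>l\<in>{0, 1, 2, 3}. \<forall>r\<in>{0, 1, 2, 3}. p ! ([h, i, j, k] ! l) < p ! ([h, i, j, k] ! r)
        \<longleftrightarrow> [4, 3, 1, 2] ! l < ([4, 3, 1, 2] ! r :: nat)"
      using *(5-7) by simp
    then show "\<forall>l<length [4, 3, 1, 2 :: nat]. \<forall>r<length [4, 3, 1, 2 :: nat].
        p ! ([h, i, j, k] ! l) < p ! ([h, i, j, k] ! r)
        \<longleftrightarrow> [4, 3, 1, 2] ! l < ([4, 3, 1, 2] ! r :: nat)"
      unfolding four[symmetric] by simp
  qed
qed

lemma asc_below_map:
  assumes "strict_mono g" "\<And>x. g x < t \<longleftrightarrow> x < t'"
  shows "asc_below t (map g l) \<longleftrightarrow> asc_below t' l"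
  by (induction l) (auto simp: assms strict_mono_less)

lemma has312_below_map:
  assumes "strict_mono g" "\<And>x. g x < t \<longleftrightarrow> x < t'"
  shows "has312_below t (map g l) \<longleftrightarrow> has312_below t' l"
  by (induction l) (auto simp: assms strict_mono_less asc_below_map)

lemma has4312_map:
  assumes "strict_mono g"
  shows "has4312 (map g l) \<longleftrightarrow> has4312 l"
  by (induction l) (auto simp: assms strict_mono_less has312_below_map)

lemma has312_below_mono: "has312_below t l \<Longrightarrow> t \<le> u \<Longrightarrow> has312_below u l"
  by (induction l) auto

text \<open>
  An ascent top below \<open>x + 1\<close> is below \<open>x\<close>, because \<open>x\<close> itself does not occur in the word.
\<close>

lemma asc_below_lower: "asc_below t l \<Longrightarrow> t \<le> Suc x \<Longrightarrow> x \<notin> set l \<Longrightarrow> asc_below x l"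
proof (induction l)
  case (Cons a l)
  then show ?case by (auto simp: less_Suc_eq dest: order.strict_trans2)
qed simp

lemma alternating_Cons_Cons:
  "alternating (a # c # l) \<longleftrightarrow> a < c \<and> (l \<noteq> [] \<longrightarrow> hd l < c) \<and> alternating l"
proof -
  have all: "(\<forall>i. P i) \<longleftrightarrow> P 0 \<and> P (Suc 0) \<and> (\<forall>i. P (Suc (Suc i)))" for P :: "nat \<Rightarrow> bool"
    by (metis not0_implies_Suc)
  show ?thesis
    unfolding alternating_def by (subst all) (auto simp: hd_conv_nth)
qed

lemma alternating_map:
  assumes "strict_mono g"
  shows "alternating (map g l) \<longleftrightarrow> alternating l"
  by (auto simp: alternating_def strict_mono_less[OF assms])

text \<open>
  Making room for a new letter \<open>a\<close>: the map keeps the relative order and misses exactly the value \<open>a\<close>.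
\<close>

definition shift :: "nat \<Rightarrow> nat \<Rightarrow> nat" where
  "shift a x = (if a \<le> x then Suc x else x)"

lemma strict_mono_shift: "strict_mono (shift a)"
  by (auto simp: strict_mono_def shift_def)

lemma shift_less_iff: "shift a x < t \<longleftrightarrow> x < (if t \<le> a then t else t - 1)"
  by (auto simp: shift_def)

lemma asc_below_shift: "asc_below t (map (shift a) l) \<longleftrightarrow> asc_below (if t \<le> a then t else t - 1) l"
  by (rule asc_below_map[OF strict_mono_shift shift_less_iff])

lemma has312_below_shift:
  "has312_below t (map (shift a) l) \<longleftrightarrow> has312_below (if t \<le> a then t else t - 1) l"
  by (rule has312_below_map[OF strict_mono_shift shift_less_iff])

definition prepend :: "nat \<Rightarrow> nat list \<Rightarrow> nat list" where
  "prepend a l = a # map (shift a) l"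

lemma shift_image:
  assumes "a \<in> {1..Suc N}"
  shows "shift a ` {1..N} = {1..Suc N} - {a}"
proof (intro equalityI subsetI)
  fix y assume y: "y \<in> {1..Suc N} - {a}"
  then have "y = shift a (if y < a then y else y - 1)" "(if y < a then y else y - 1) \<in> {1..N}"
    using assms by (auto simp: shift_def)
  then show "y \<in> shift a ` {1..N}" by blast
qed (use assms in \<open>auto simp: shift_def split: if_splits\<close>)

abbreviation perms :: "nat \<Rightarrow> nat list set" where
  "perms N \<equiv> permutations_of_set {1..N}"

lemma perms_Suc: "perms (Suc N) = (\<lambda>(a, l). prepend a l) ` ({1..Suc N} \<times> perms N)"
proof (intro equalityI subsetI)
  fix p assume "p \<in> perms (Suc N)"
  then have p: "set p = {1..Suc N}" "distinct p" by (auto simp: permutations_of_set_def)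
  then obtain a q where q: "p = a # q" by (cases p) auto
  have a: "a \<in> {1..Suc N}" using p q by auto
  have "set q = shift a ` {1..N}" using p q shift_image[OF a] by auto
  then obtain l where l: "q = map (shift a) l"
    by (metis ex_map_conv imageE)
  have "inj (shift a)" using strict_mono_shift strict_mono_imp_inj_on by blast
  then have "set l = {1..N}"
    using \<open>set q = _\<close> l by (simp add: inj_image_eq_iff)
  moreover have "distinct l" using p q l by (simp add: distinct_map)
  ultimately show "p \<in> (\<lambda>(a, l). prepend a l) ` ({1..Suc N} \<times> perms N)"
    using a q l by (auto simp: prepend_def permutations_of_set_def intro!: rev_image_eqI[of "(a, l)"])
next
  fix p assume "p \<in> (\<lambda>(a, l). prepend a l) ` ({1..Suc N} \<times> perms N)"
  then obtain a l where al: "a \<in> {1..Suc N}" "l \<in> perms N" "p = prepend a l" by auto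
  have "inj (shift a)" using strict_mono_shift strict_mono_imp_inj_on by blast
  then show "p \<in> perms (Suc N)"
    using al shift_image[OF al(1)]
    by (auto simp: permutations_of_set_def prepend_def distinct_map intro: inj_on_subset)
qed

lemma prepend_inject: "prepend a l = prepend a' l' \<longleftrightarrow> a = a' \<and> l = l'"
proof -
  have "inj (shift a)" using strict_mono_shift strict_mono_imp_inj_on by blast
  then show ?thesis by (auto simp: prepend_def)
qed

lemma length_perms: "l \<in> perms N \<Longrightarrow> length l = N"
  by (simp add: length_finite_permutations_of_set)

text \<open>
  The value 0 for the empty word makes the conditions on prolongations hold uniformly: there is no
  letter that the new second letter has to exceed.
\<close>

definition first :: "nat list \<Rightarrow> nat" where
  "first l = (if l = [] then 0 else hd l)"

text \<open>
  For a permutation of \<open>{1..N}\<close> this is the smallest letter that is the 3 of an occurrence of 312, or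
  \<open>N + 1\<close> if 312 is avoided. A letter may be put in front without creating an occurrence of 4312
  if and only if its value is at most this bound.
\<close>

definition top312 :: "nat list \<Rightarrow> nat" where
  "top312 l = Max {t. t \<le> Suc (length l) \<and> \<not> has312_below t l}"

lemma has312_below_0: "\<not> has312_below 0 l"
  by (induction l) auto

lemma top312_le: "top312 l \<le> Suc (length l)"
  and not_has312_below_top: "\<not> has312_below (top312 l) l"
  and le_top312: "t \<le> Suc (length l) \<Longrightarrow> \<not> has312_below t l \<Longrightarrow> t \<le> top312 l"
proof -
  let ?S = "{t. t \<le> Suc (length l) \<and> \<not> has312_below t l}"
  have fin: "finite ?S" by (rule finite_subset[of _ "{..Suc (length l)}"]) auto
  have "0 \<in> ?S" using has312_below_0 by simp
  then have "top312 l \<in> ?S" unfolding top312_def using fin Max_in by blast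
  then show "top312 l \<le> Suc (length l)" "\<not> has312_below (top312 l) l" by simp_all
  show "t \<le> top312 l" if "t \<le> Suc (length l)" "\<not> has312_below t l"
    unfolding top312_def using fin that by (intro Max_ge) auto
qed

lemma has312_below_iff_top:
  assumes "t \<le> Suc (length l)"
  shows "has312_below t l \<longleftrightarrow> top312 l < t"
  using assms le_top312[of t l] not_has312_below_top[of l] has312_below_mono[of t l "top312 l"]
  by fastforce

lemma top312_eqI:
  assumes "m \<le> Suc (length l)" "\<And>t. t \<le> Suc (length l) \<Longrightarrow> has312_below t l \<longleftrightarrow> m < t"
  shows "top312 l = m"
  using assms has312_below_iff_top[of m l] has312_below_iff_top[of "top312 l" l] top312_le[of l]
  by fastforce

text \<open>
  If no occurrence of 312 has its top at most the first letter \<open>f\<close>, then the letters below \<open>f\<close>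
  appear in decreasing order, as otherwise \<open>f\<close> would be such a top. Hence the smallest ascent top,
  if there is any, is \<open>f + 1\<close>, and the ascents add no information to the two statistics.
\<close>

lemma asc_below_iff_first:
  assumes "l \<in> perms N" "first l < top312 l" "t \<le> Suc N"
  shows "asc_below t l \<longleftrightarrow> Suc (first l) < t"
proof (cases l)
  case Nil
  then show ?thesis using assms by (auto simp: first_def permutations_of_set_def)
next
  case (Cons x q)
  have len: "length l = N" using assms(1) by (rule length_perms)
  have set: "set l = {1..N}" "distinct l" using assms(1) by (auto simp: permutations_of_set_def)
  have x: "x \<le> N" "x \<notin> set q" "first l = x" using set Cons by (auto simp: first_def)
  have "\<not> has312_below (Suc x) l"
    using has312_below_iff_top[of "Suc x" l] len x assms(2) by simp
  then have no: "\<not> asc_below x q" by (simp add: Cons)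
  show ?thesis
  proof (cases "Suc x < t")
    case True
    then have "Suc x \<in> set l" using set assms(3) by auto
    then show ?thesis using True x Cons by auto
  next
    case False
    then show ?thesis using no asc_below_lower[of t q x] x Cons by auto
  qed
qed

text \<open>
  The value \<open>b\<close> is relative to the word without \<open>a\<close>. In the result it becomes \<open>b + 1\<close> for \<open>a \<le> b\<close>, so an
  ascent \<open>a < b + 1\<close> is the condition \<open>a \<le> b\<close>.
\<close>

definition extend :: "nat \<Rightarrow> nat \<Rightarrow> nat list \<Rightarrow> nat list" where
  "extend a b l = prepend a (prepend b l)"

text \<open>
  Of the two new letters only the larger one imposes a condition related to 4312: an occurrence that
  starts at the smaller letter \<open>a\<close> could start at its right neighbour instead.
\<close>

lemma extend_good_iff:
  assumes "l \<in> perms N" "1 \<le> b" "b \<le> Suc N"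
  shows "alternating (extend a b l) \<and> \<not> has4312 (extend a b l) \<longleftrightarrow>
    alternating l \<and> \<not> has4312 l \<and> a \<le> b \<and> first l < b \<and> b \<le> top312 l"
proof -
  have alt: "alternating (extend a b l) \<longleftrightarrow> a \<le> b \<and> first l < b \<and> alternating l"
    using assms(2)
    by (auto simp: extend_def prepend_def alternating_Cons_Cons first_def shift_def hd_map
        alternating_map strict_mono_shift simp flip: map_map)
  have "has312_below b (map (shift b) l) \<longleftrightarrow> top312 l < b"
    using has312_below_shift[of b b l]
      has312_below_iff_top[of b l] assms length_perms[of l N] by simp
  moreover have "has312_below a (prepend b l) \<longleftrightarrow> has312_below a l" if "a \<le> b"
    using that has312_below_shift[of a b l]
    by (simp add: prepend_def)
  moreover have "has312_below a (map (shift a) (prepend b l)) \<longleftrightarrow> has312_below a (prepend b l)"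
    using has312_below_shift[of a a "prepend b l"] by simp
  moreover have "has4312 (extend a b l) \<longleftrightarrow>
     has312_below a (map (shift a) (prepend b l)) \<or> has312_below b (map (shift b) l) \<or> has4312 l"
  proof -
    have "has4312 (extend a b l) \<longleftrightarrow>
      has312_below a (map (shift a) (prepend b l)) \<or> has4312 (prepend b l)"
      by (subst has4312_map[OF strict_mono_shift, of a, symmetric])
        (auto simp: extend_def prepend_def)
    also have "has4312 (prepend b l) \<longleftrightarrow> has312_below b (map (shift b) l) \<or> has4312 l"
      by (subst (2) has4312_map[OF strict_mono_shift, of b, symmetric]) (auto simp: prepend_def)
    finally show ?thesis .
  qed
  moreover have "\<not> has312_below a l" if "a \<le> b" "b \<le> top312 l"
    using has312_below_iff_top[of a l] assms that length_perms[of l N] by simp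
  ultimately show ?thesis using alt by auto
qed

lemma first_extend: "first (extend a b l) = a"
  by (simp add: first_def extend_def prepend_def)

text \<open>
  The new occurrences of 312 start at one of the new letters. The larger one, \<open>b\<close>, starts one if and
  only if it exceeds the smallest ascent top \<open>f + 1\<close>; its final value is then \<open>b + 1\<close>, which is at
  most the raised old bound. Otherwise the old bound is raised by the two insertions. The smaller one,
  \<open>a\<close>, starts one if and only if \<open>a > f + 1\<close>.
\<close>

lemma has312_below_extend:
  assumes "l \<in> perms N" "first l < b" "b \<le> top312 l" "a \<le> b" "t \<le> N + 3"
  shows "has312_below t (extend a b l) \<longleftrightarrow>
    (if b = Suc (first l) then top312 l + 2 else Suc b) < t \<or> Suc (first l) < a \<and> a < t"
proof -
  have len: "length l = N" using assms(1) by (rule length_perms)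
  have b: "b \<le> Suc N" using top312_le[of l] assms len by simp
  have asc: "asc_below u l \<longleftrightarrow> Suc (first l) < u" if "u \<le> Suc N" for u
    using asc_below_iff_first[OF assms(1) _ that] assms by simp
  have h: "has312_below u l \<longleftrightarrow> top312 l < u" if "u \<le> Suc N" for u
    using has312_below_iff_top[of u l] that len by simp
  have h1: "has312_below u (prepend b l) \<longleftrightarrow> (if b = Suc (first l) then Suc (top312 l) else b) < u"
    if "u \<le> N + 2" for u
    using has312_below_shift[of u b l]
      asc_below_shift[of b b l]
      asc[OF b] h[of u] h[of "u - 1"] assms b that
    by (auto simp: prepend_def split: if_splits)
  have asc1: "asc_below a (prepend b l) \<longleftrightarrow> Suc (first l) < a"
    using asc_below_shift[of a b l] asc[of a] assms b
    by (auto simp: prepend_def)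
  have "has312_below t (extend a b l) \<longleftrightarrow>
      has312_below (if t \<le> a then t else t - 1) (prepend b l) \<or> a < t \<and> Suc (first l) < a"
    using has312_below_shift[of t a "prepend b l"] asc_below_shift[of a a "prepend b l"] asc1
    by (auto simp: extend_def prepend_def[of a])
  also have "has312_below (if t \<le> a then t else t - 1) (prepend b l) \<longleftrightarrow>
      (if b = Suc (first l) then top312 l + 2 else Suc b) < t"
  proof (cases "t \<le> a")
    case True
    then show ?thesis using h1[of t] assms b by auto
  next
    case False
    then show ?thesis using h1[of "t - 1"] assms b by auto
  qed
  finally show ?thesis by auto
qed

section \<open>Counting the alternating avoiders\<close>

definition avoiders :: "nat \<Rightarrow> nat list set" where
  "avoiders n = {p \<in> perms (2 * n). alternating p \<and> \<not> has4312 p}"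

text \<open>
  The words that can be the tail of a longer word of the same kind: a letter put in front must exceed
  the first letter, and it must not exceed the smallest top of a 312.
\<close>

definition extensible :: "nat \<Rightarrow> nat list set" where
  "extensible n = {p \<in> avoiders n. first p < top312 p}"

lemma extensible_extend_iff:
  assumes "l \<in> perms N" "first l < b" "b \<le> top312 l" "a \<le> b"
  shows "first (extend a b l) < top312 (extend a b l) \<longleftrightarrow> a \<le> Suc (first l)"
proof -
  have "b \<le> Suc N" using top312_le[of l] length_perms[OF assms(1)] assms(3) by simp
  moreover have "length (extend a b l) = N + 2"
    using length_perms[OF assms(1)] by (simp add: extend_def prepend_def)
  ultimately show ?thesis
    using has312_below_iff_top[of "Suc a" "extend a b l"]
      has312_below_extend[OF assms, of "Suc a"] assms
    by (auto simp: first_extend split: if_splits)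
qed

lemma top312_extend:
  assumes "l \<in> perms N" "first l < b" "b \<le> top312 l" "1 \<le> a" "a \<le> Suc (first l)"
  shows "top312 (extend a b l) = (if b = Suc (first l) then top312 l + 2 else Suc b)"
proof (rule top312_eqI)
  have len: "length (extend a b l) = N + 2"
    using length_perms[OF assms(1)] by (simp add: extend_def prepend_def)
  have "top312 l \<le> Suc N" using top312_le[of l] length_perms[OF assms(1)] by simp
  then show "(if b = Suc (first l) then top312 l + 2 else Suc b) \<le> Suc (length (extend a b l))"
    using assms len by simp
  show "has312_below t (extend a b l) \<longleftrightarrow>
      (if b = Suc (first l) then top312 l + 2 else Suc b) < t"
    if "t \<le> Suc (length (extend a b l))" for t
    using has312_below_extend[OF assms(1-3), of a t] assms that len by simp
qed

lemma extend_inject: "extend a b l = extend a' b' l' \<longleftrightarrow> a = a' \<and> b = b' \<and> l = l'"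
  by (simp add: extend_def prepend_inject)

lemma perms_Suc_iff:
  "p \<in> perms (Suc N) \<longleftrightarrow> (\<exists>a l. p = prepend a l \<and> a \<in> {1..Suc N} \<and> l \<in> perms N)"
  unfolding perms_Suc by (fastforce simp: image_iff)

lemma perms_Suc_Suc:
  "p \<in> perms (Suc (Suc N)) \<longleftrightarrow>
    (\<exists>a b l. p = extend a b l \<and> a \<in> {1..Suc (Suc N)} \<and> b \<in> {1..Suc N} \<and> l \<in> perms N)"
  unfolding perms_Suc_iff extend_def by blast

text \<open>
  Removing the first two letters leaves an extensible word, and the possible choices of the two
  letters depend only on its two statistics.
\<close>

lemma avoiders_Suc:
  "avoiders (Suc n) = (\<lambda>(l, b, a). extend a b l) `
     (SIGMA l:extensible n. SIGMA b:{Suc (first l)..top312 l}. {1..b})" (is "_ = ?f ` ?S")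
proof (intro equalityI subsetI)
  fix p assume p: "p \<in> avoiders (Suc n)"
  then have "p \<in> perms (Suc (Suc (2 * n)))" by (simp add: avoiders_def)
  then obtain a b l where abl: "p = extend a b l" "a \<ge> 1" "b \<in> {1..Suc (2 * n)}" "l \<in> perms (2 * n)"
    unfolding perms_Suc_Suc by auto
  have "(l, b, a) \<in> ?S"
    using p extend_good_iff[of l "2 * n" b a] abl by (auto simp: avoiders_def extensible_def)
  then show "p \<in> ?f ` ?S" using abl(1) by (intro image_eqI[of _ _ "(l, b, a)"]) auto
next
  fix p assume "p \<in> ?f ` ?S"
  then obtain l b a where lba: "p = extend a b l" "l \<in> extensible n" "Suc (first l) \<le> b"
    "b \<le> top312 l" "1 \<le> a" "a \<le> b" by auto
  then have l: "l \<in> perms (2 * n)" "length l = 2 * n"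
    using length_perms by (auto simp: extensible_def avoiders_def)
  then have b: "b \<le> Suc (2 * n)" using lba top312_le[of l] by simp
  have "p \<in> perms (Suc (Suc (2 * n)))"
    unfolding perms_Suc_Suc using lba l b by fastforce
  then show "p \<in> avoiders (Suc n)"
    using extend_good_iff[of l "2 * n" b a] lba l b by (auto simp: avoiders_def extensible_def)
qed

lemma extensible_Suc:
  "extensible (Suc n) = (\<lambda>(l, a, b). extend a b l) `
     (SIGMA l:extensible n. {1..Suc (first l)} \<times> {Suc (first l)..top312 l})" (is "_ = ?f ` ?S")
proof (intro equalityI subsetI)
  fix p assume "p \<in> extensible (Suc n)"
  then have p: "p \<in> avoiders (Suc n)" "first p < top312 p" by (auto simp: extensible_def)
  from p(1) obtain l b a where lba: "p = extend a b l" "l \<in> extensible n" "Suc (first l) \<le> b"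
    "b \<le> top312 l" "1 \<le> a" "a \<le> b" unfolding avoiders_Suc by auto
  then have "a \<le> Suc (first l)"
    using extensible_extend_iff[of l "2 * n" b a] p(2) by (auto simp: extensible_def avoiders_def)
  then show "p \<in> ?f ` ?S" using lba by (intro image_eqI[of _ _ "(l, a, b)"]) auto
next
  fix p assume "p \<in> ?f ` ?S"
  then obtain l a b where lab: "p = extend a b l" "l \<in> extensible n" "Suc (first l) \<le> b"
    "b \<le> top312 l" "1 \<le> a" "a \<le> Suc (first l)" by auto
  then have "p \<in> avoiders (Suc n)" unfolding avoiders_Suc
    by (intro image_eqI[of _ _ "(l, b, a)"]) auto
  then show "p \<in> extensible (Suc n)"
    using extensible_extend_iff[of l "2 * n" b a] lab by (auto simp: extensible_def avoiders_def)
qed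

lemma finite_extensible: "finite (extensible n)"
  by (auto simp: extensible_def avoiders_def)

text \<open>
  The statistics of the extensible prolongations of a word with statistics \<open>f, m\<close> are the pairs
  \<open>(a, c)\<close> of a rectangle, each occurring once: \<open>b = f + 1\<close> gives \<open>c = m + 2\<close>, and the other values
  of \<open>b\<close> give \<open>c = b + 1\<close>, from \<open>f + 3\<close> to \<open>m + 1\<close>.
\<close>

lemma sum_extensible_Suc:
  fixes G :: "nat \<Rightarrow> nat \<Rightarrow> real"
  shows "(\<Sum>p\<in>extensible (Suc n). G (first p) (top312 p)) =
    (\<Sum>l\<in>extensible n. \<Sum>a = 1..first l + 1. \<Sum>c = first l + 3..top312 l + 2. G a c)"
proof -
  let ?S = "SIGMA l:extensible n. {1..Suc (first l)} \<times> {Suc (first l)..top312 l}"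
  let ?t = "\<lambda>l b. if b = Suc (first l) then top312 l + 2 else Suc b"
  have inj: "inj_on (\<lambda>(l, a, b). extend a b l) ?S"
    by (auto simp: inj_on_def extend_inject)
  have row: "(\<Sum>b = Suc (first l)..top312 l. G a (?t l b)) = (\<Sum>c = first l + 3..top312 l + 2. G a c)"
    if "l \<in> extensible n" for l a
  proof -
    have less: "first l < top312 l" using that by (simp add: extensible_def)
    have "(\<Sum>b = Suc (first l)..top312 l. G a (?t l b))
        = G a (top312 l + 2) + (\<Sum>b = Suc (Suc (first l))..top312 l. G a (Suc b))"
      using less by (subst sum.atLeast_Suc_atMost) (auto intro!: sum.cong)
    also have "(\<Sum>b = Suc (Suc (first l))..top312 l. G a (Suc b))
        = (\<Sum>c = first l + 3..Suc (top312 l). G a c)"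
      using sum.shift_bounds_cl_Suc_ivl[of "G a" "Suc (Suc (first l))" "top312 l"]
      by (simp add: eval_nat_numeral)
    finally show ?thesis using less by simp
  qed
  have "(\<Sum>p\<in>extensible (Suc n). G (first p) (top312 p))
      = (\<Sum>(l, a, b)\<in>?S. G (first (extend a b l)) (top312 (extend a b l)))"
    unfolding extensible_Suc by (subst sum.reindex[OF inj]) (simp add: case_prod_unfold)
  also have "\<dots> = (\<Sum>(l, a, b)\<in>?S. G a (?t l b))"
    by (intro sum.cong)
       (auto simp: first_extend top312_extend[where N = "2 * n"] extensible_def avoiders_def)
  also have "\<dots> = (\<Sum>l\<in>extensible n. \<Sum>a = 1..first l + 1. \<Sum>b = Suc (first l)..top312 l. G a (?t l b))"
    by (simp add: sum.Sigma finite_extensible sum.cartesian_product case_prod_unfold)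
  also have "\<dots> = (\<Sum>l\<in>extensible n. \<Sum>a = 1..first l + 1. \<Sum>c = first l + 3..top312 l + 2. G a c)"
    by (intro sum.cong refl row)
  finally show ?thesis .
qed

text \<open>
  Each prolongation by a pair of letters trades one unit of \<open>n\<close> for one unit of \<open>k\<close>, down to the
  empty word with statistics \<open>0, 1\<close>.
\<close>

lemma sum_extensible_H: "(\<Sum>l\<in>extensible n. H k (first l) (top312 l)) = H (n + k) 0 1"
proof (induction n arbitrary: k)
  case 0
  have "top312 [] = 1" by (rule top312_eqI) auto
  then have "extensible 0 = {[]}"
    by (auto simp: extensible_def avoiders_def alternating_def first_def)
  then show ?case using \<open>top312 [] = 1\<close> by (simp add: first_def)
next
  case (Suc n)
  have "(\<Sum>l\<in>extensible (Suc n). H k (first l) (top312 l))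
      = (\<Sum>l\<in>extensible n. H (Suc k) (first l) (top312 l))"
    unfolding sum_extensible_Suc[of "\<lambda>a c. H k (real a) (real c)"]
    by (intro sum.cong refl sum_H) (simp add: extensible_def)
  then show ?case by (simp add: Suc.IH)
qed

text \<open>
  In the last prolongation the new word need not be extensible, so \<open>a\<close> ranges up to \<open>b\<close>; the number
  of choices is a difference of triangular numbers, which is \<^term>\<open>H 0\<close>.
\<close>

lemma card_avoiders: "real (card (avoiders (Suc n))) = H n 0 1"
proof -
  have gauss: "(\<Sum>b = Suc f..m. real b) = H 0 f m" if "f \<le> m" for f m
    using that
  proof (induction m rule: dec_induct)
    case (step m)
    then show ?case by (simp add: H_0[of f m] H_0[of f "Suc m"] field_simps del: of_nat_Suc)
        (simp add: algebra_simps)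
  qed (simp add: H_diagonal)
  have "inj_on (\<lambda>(l, b, a). extend a b l) (SIGMA l:extensible n. SIGMA b:{Suc (first l)..top312 l}. {1..b})"
    by (auto simp: inj_on_def extend_inject)
  then have "card (avoiders (Suc n)) = (\<Sum>l\<in>extensible n. \<Sum>b = Suc (first l)..top312 l. b)"
    unfolding avoiders_Suc by (simp add: card_image card_SigmaI finite_extensible)
  then have "real (card (avoiders (Suc n))) = (\<Sum>l\<in>extensible n. H 0 (first l) (top312 l))"
    by (simp add: gauss extensible_def)
  then show ?thesis by (simp add: sum_extensible_H)
qed

section \<open>Counting shifted tableaux with three rows\<close>

text \<open>
  Standard fillings of an arbitrary finite set of cells, for an arbitrary relation that they have to
  respect. Shifted tableaux are the instance given by \<open>SHSYT_3\<close> below.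
\<close>

definition linear_extensions :: "('a \<Rightarrow> 'a \<Rightarrow> bool) \<Rightarrow> 'a set \<Rightarrow> ('a \<Rightarrow> nat) set" where
  "linear_extensions R D = {T \<in> extensional D.
     bij_betw T D {1..card D} \<and> (\<forall>x\<in>D. \<forall>y\<in>D. R x y \<longrightarrow> T x < T y)}"

lemma linear_extensions_empty: "linear_extensions R {} = {\<lambda>_. undefined}"
  by (auto simp: linear_extensions_def bij_betw_def)

lemma finite_linear_extensions:
  assumes "finite D"
  shows "finite (linear_extensions R D)"
proof (rule finite_subset)
  show "linear_extensions R D \<subseteq> D \<rightarrow>\<^sub>E {1..card D}"
    by (auto simp: linear_extensions_def PiE_def bij_betw_def)
  show "finite (D \<rightarrow>\<^sub>E {1..card D})" using assms by (intro finite_PiE) auto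
qed

lemma linear_extensions_top:
  assumes "finite D" "x \<in> D" "\<forall>y\<in>D. \<not> R x y"
  shows "bij_betw (\<lambda>T. T(x := card D)) (linear_extensions R (D - {x}))
           {T \<in> linear_extensions R D. T x = card D}"
proof (rule bij_betwI[where g = "\<lambda>T. T(x := undefined)"])
  have card: "card D = Suc (card (D - {x}))" using card_Suc_Diff1[OF assms(1,2)] by simp
  have ins: "insert (card D) {1..card (D - {x})} = {1..card D}" using card by auto
  have D: "D = insert x (D - {x})" using assms by auto
  show "(\<lambda>T. T(x := card D)) \<in> linear_extensions R (D - {x}) \<rightarrow>
      {T \<in> linear_extensions R D. T x = card D}"
  proof
    fix T assume T: "T \<in> linear_extensions R (D - {x})"
    let ?T = "T(x := card D)"
    have bij: "bij_betw T (D - {x}) {1..card (D - {x})}" using T by (simp add: linear_extensions_def)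
    have "bij_betw ?T (D - {x}) {1..card (D - {x})}"
      using bij by (subst bij_betw_cong[of _ _ T]) auto
    then have "bij_betw ?T (insert x (D - {x})) (insert (card D) {1..card (D - {x})})"
      using notIn_Un_bij_betw[of x "D - {x}" ?T "{1..card (D - {x})}"] card by simp
    then have "bij_betw ?T D {1..card D}" using D ins by metis
    moreover have "?T \<in> extensional D" using T assms by (auto simp: linear_extensions_def extensional_def)
    moreover have "?T y < ?T z" if yz: "y \<in> D" "z \<in> D" "R y z" for y z
    proof -
      have "y \<noteq> x" using yz assms by auto
      moreover have "T y < card D" if "y \<noteq> x"
        using bij_betwE[OF bij] that yz card by (metis Diff_iff atLeastAtMost_iff less_Suc_eq_le singletonD)
      ultimately show ?thesis using yz T by (auto simp: linear_extensions_def)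
    qed
    ultimately show "?T \<in> {T \<in> linear_extensions R D. T x = card D}"
      by (simp add: linear_extensions_def)
  qed
  show "(\<lambda>T. T(x := undefined)) \<in> {T \<in> linear_extensions R D. T x = card D} \<rightarrow>
      linear_extensions R (D - {x})"
  proof
    fix T assume "T \<in> {T \<in> linear_extensions R D. T x = card D}"
    then have T: "T \<in> linear_extensions R D" "T x = card D" by auto
    have "bij_betw T (D - {x}) ({1..card D} - {T x})"
      using T(1) assms(2) by (intro bij_betw_DiffI) (auto simp: linear_extensions_def bij_betw_def)
    moreover have "{1..card D} - {T x} = {1..card (D - {x})}" using T(2) card by auto
    ultimately have "bij_betw (T(x := undefined)) (D - {x}) {1..card (D - {x})}"
      by (subst bij_betw_cong[of _ _ T]) auto
    then show "T(x := undefined) \<in> linear_extensions R (D - {x})"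
      using T by (auto simp: linear_extensions_def extensional_def)
  qed
qed (auto simp: linear_extensions_def extensional_def fun_eq_iff)

text \<open>
  The cell carrying the largest entry is maximal, and removing it leaves a standard filling of the
  remaining cells.
\<close>

lemma card_linear_extensions:
  assumes "finite D" "D \<noteq> {}"
  shows "card (linear_extensions R D)
    = (\<Sum>x | x \<in> D \<and> (\<forall>y\<in>D. \<not> R x y). card (linear_extensions R (D - {x})))"
proof -
  let ?M = "{x. x \<in> D \<and> (\<forall>y\<in>D. \<not> R x y)}"
  let ?L = "\<lambda>x. {T \<in> linear_extensions R D. T x = card D}"
  have "linear_extensions R D = (\<Union>x\<in>?M. ?L x)"
  proof (intro equalityI subsetI)
    fix T assume T: "T \<in> linear_extensions R D"
    then have bij: "bij_betw T D {1..card D}" by (simp add: linear_extensions_def)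
    have "card D \<in> {1..card D}" using assms by (simp add: Suc_le_eq card_gt_0_iff)
    then obtain x where x: "x \<in> D" "T x = card D" using bij by (metis bij_betw_iff_bijections)
    have "\<not> R x y" if "y \<in> D" for y
    proof
      assume "R x y"
      then have "card D < T y" using T x that by (auto simp: linear_extensions_def)
      then show False using bij_betwE[OF bij] that by fastforce
    qed
    then show "T \<in> (\<Union>x\<in>?M. ?L x)" using x T by auto
  qed auto
  moreover have "card (\<Union>x\<in>?M. ?L x) = (\<Sum>x\<in>?M. card (?L x))"
  proof (rule card_UN_disjoint)
    show "finite ?M" using assms by simp
    show "\<forall>x\<in>?M. finite (?L x)" using finite_linear_extensions[OF assms(1)] by simp
    show "\<forall>x\<in>?M. \<forall>y\<in>?M. x \<noteq> y \<longrightarrow> ?L x \<inter> ?L y = {}"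
      by (auto simp: linear_extensions_def bij_betw_def inj_on_def)
  qed
  moreover have "card (?L x) = card (linear_extensions R (D - {x}))" if "x \<in> ?M" for x
    using bij_betw_same_card[OF linear_extensions_top[of D x R]] that assms by simp
  ultimately show ?thesis by simp
qed

definition cell_less :: "nat \<times> nat \<Rightarrow> nat \<times> nat \<Rightarrow> bool" where
  "cell_less x y \<longleftrightarrow> fst x = fst y \<and> snd x < snd y \<or> snd x = snd y \<and> fst x < fst y"

lemma shifted_diagram_3:
  "shifted_diagram [a, b, c] = {1} \<times> {1..a} \<union> {2} \<times> {2..b + 1} \<union> {3} \<times> {3..c + 2}"
proof (intro set_eqI)
  fix x
  obtain i j :: nat where [simp]: "x = (i, j)" by fastforce
  consider "i = 0" | "i = 1" | "i = 2" | "i = 3" | "i > 3" by linarith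
  then show "x \<in> shifted_diagram [a, b, c] \<longleftrightarrow>
      x \<in> {1} \<times> {1..a} \<union> {2} \<times> {2..b + 1} \<union> {3} \<times> {3..c + 2}"
    by cases (auto simp: shifted_diagram_def numeral_2_eq_2 numeral_3_eq_3)
qed

lemma card_shifted_diagram_3: "card (shifted_diagram [a, b, c]) = a + b + c"
  unfolding shifted_diagram_3
  by (subst card_Un_disjoint; (subst card_Un_disjoint)?) (auto simp: card_cartesian_product)

lemma finite_shifted_diagram_3: "finite (shifted_diagram [a, b, c])"
  by (simp add: shifted_diagram_3)

lemma SHSYT_3: "SHSYT [a, b, c] = linear_extensions cell_less (shifted_diagram [a, b, c])"
proof -
  have "(\<forall>i j j'. (i, j) \<in> D \<and> (i, j') \<in> D \<and> j < j' \<longrightarrow> T (i, j) < T (i, j')) \<and>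
      (\<forall>i i' j. (i, j) \<in> D \<and> (i', j) \<in> D \<and> i < i' \<longrightarrow> T (i, j) < T (i', j))
    \<longleftrightarrow> (\<forall>x\<in>D. \<forall>y\<in>D. cell_less x y \<longrightarrow> T x < T y)"
    for D and T :: "nat \<times> nat \<Rightarrow> nat"
    by (auto simp: cell_less_def)
  then show ?thesis
    unfolding SHSYT_def linear_extensions_def card_shifted_diagram_3 by (simp add: add.assoc)
qed

definition num_tableaux :: "nat \<Rightarrow> nat \<Rightarrow> nat \<Rightarrow> nat" where
  "num_tableaux a b c = card (SHSYT [a, b, c])"

lemma num_tableaux_0: "num_tableaux 0 0 0 = 1"
proof -
  have "shifted_diagram [0, 0, 0] = {}" by (simp add: shifted_diagram_3)
  then show ?thesis by (simp only: num_tableaux_def SHSYT_3 linear_extensions_empty) simp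
qed

text \<open>
  The maximal cells are the ends of those rows that can be shortened so that the row lengths stay
  strictly decreasing, up to empty rows.
\<close>

lemma num_tableaux_rec:
  assumes "b < a" "c < b \<or> b = 0 \<and> c = 0"
  shows "num_tableaux a b c = (if b = 0 \<or> b + 1 < a then num_tableaux (a - 1) b c else 0)
     + (if 0 < b \<and> (c = 0 \<or> c + 1 < b) then num_tableaux a (b - 1) c else 0)
     + (if 0 < c then num_tableaux a b (c - 1) else 0)"
proof -
  let ?D = "shifted_diagram [a, b, c]"
  let ?F = "\<lambda>x. card (linear_extensions cell_less (?D - {x}))"
  have ne: "?D \<noteq> {}" using assms by (auto simp: shifted_diagram_3)
  have corners: "{x. x \<in> ?D \<and> (\<forall>y\<in>?D. \<not> cell_less x y)}
     = (if b = 0 \<or> b + 1 < a then {(1, a)} else {})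
     \<union> (if 0 < b \<and> (c = 0 \<or> c + 1 < b) then {(2, b + 1)} else {})
     \<union> (if 0 < c then {(3, c + 2)} else {})" (is "?M = ?A \<union> ?B \<union> ?C")
  proof (intro equalityI subsetI)
    fix x assume "x \<in> ?A \<union> ?B \<union> ?C"
    then show "x \<in> ?M"
      using assms by (auto simp: shifted_diagram_3 cell_less_def split: if_splits)
  next
    fix x assume x: "x \<in> ?M"
    obtain i j where ij: "x = (i, j)" by fastforce
    have no: "(i, Suc j) \<notin> ?D" "(Suc i, j) \<notin> ?D" using x by (auto simp: ij cell_less_def)
    have "(i, j) \<in> ?D" using x ij by simp
    then show "x \<in> ?A \<union> ?B \<union> ?C"
      unfolding shifted_diagram_3
    proof (elim UnE)
      assume "(i, j) \<in> {1} \<times> {1..a}"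
      then have "i = 1" "j = a" "b = 0 \<or> b + 1 < a"
        using no assms by (auto simp: shifted_diagram_3)
      then show ?thesis using ij by simp
    next
      assume "(i, j) \<in> {2} \<times> {2..b + 1}"
      then have "i = 2" "j = b + 1" "0 < b" "c = 0 \<or> c + 1 < b"
        using no assms by (auto simp: shifted_diagram_3)
      then show ?thesis using ij by simp
    next
      assume "(i, j) \<in> {3} \<times> {3..c + 2}"
      then have "i = 3" "j = c + 2" "0 < c"
        using no by (auto simp: shifted_diagram_3)
      then show ?thesis using ij by simp
    qed
  qed
  have "num_tableaux a b c = sum ?F ?M"
    unfolding num_tableaux_def SHSYT_3 by (rule card_linear_extensions[OF finite_shifted_diagram_3 ne])
  also have "\<dots> = sum ?F ?A + sum ?F ?B + sum ?F ?C"
    unfolding corners by (subst sum.union_disjoint; (subst sum.union_disjoint)?) auto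
  also have "sum ?F ?A = (if b = 0 \<or> b + 1 < a then num_tableaux (a - 1) b c else 0)"
  proof -
    have "?D - {(1, a)} = shifted_diagram [a - 1, b, c]" by (auto simp: shifted_diagram_3)
    then show ?thesis by (simp add: num_tableaux_def SHSYT_3)
  qed
  also have "sum ?F ?B = (if 0 < b \<and> (c = 0 \<or> c + 1 < b) then num_tableaux a (b - 1) c else 0)"
  proof -
    have "?D - {(2, b + 1)} = shifted_diagram [a, b - 1, c]" if "0 < b"
      using that by (auto simp: shifted_diagram_3)
    then show ?thesis by (simp add: num_tableaux_def SHSYT_3)
  qed
  also have "sum ?F ?C = (if 0 < c then num_tableaux a b (c - 1) else 0)"
  proof -
    have "?D - {(3, c + 2)} = shifted_diagram [a, b, c - 1]" if "0 < c"
      using that by (auto simp: shifted_diagram_3)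
    then show ?thesis by (simp add: num_tableaux_def SHSYT_3)
  qed
  finally show ?thesis .
qed

definition pair_product :: "real \<Rightarrow> real \<Rightarrow> real \<Rightarrow> real" where
  "pair_product x y z = (x - y) * (x - z) * (y - z) / ((x + y) * (x + z) * (y + z))"

text \<open>
  The terms have the common denominator \<open>M\<close>, and the numerators satisfy a polynomial identity.
\<close>

lemma pair_product_rec:
  assumes "x > 1" "y > 1" "z \<ge> 0"
  shows "(x + y + z) * pair_product x y z
    = x * pair_product (x - 1) y z + y * pair_product x (y - 1) z + z * pair_product x y (z - 1)"
proof -
  define p q r where pqr: "p = x + y" "q = x + z" "r = y + z"
  have ne: "p \<noteq> 0" "q \<noteq> 0" "r \<noteq> 0" "p - 1 \<noteq> 0" "q - 1 \<noteq> 0" "r - 1 \<noteq> 0"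
    using assms by (auto simp: pqr)
  define M where "M = p * q * r * (p - 1) * (q - 1) * (r - 1)"
  have P: "pair_product x y z = (x - y) * (x - z) * (y - z) * ((p - 1) * (q - 1) * (r - 1)) / M"
    using ne by (simp add: pair_product_def M_def pqr[symmetric])
  have X: "pair_product (x - 1) y z = (x - 1 - y) * (x - 1 - z) * (y - z) * (p * q * (r - 1)) / M"
  proof -
    have e: "x - 1 + y = p - 1" "x - 1 + z = q - 1" by (simp_all add: pqr)
    show ?thesis
      unfolding pair_product_def e pqr(3)[symmetric] M_def using ne by (simp add: divide_simps)
  qed
  have Y: "pair_product x (y - 1) z = (x - (y - 1)) * (x - z) * (y - 1 - z) * (p * r * (q - 1)) / M"
  proof -
    have e: "x + (y - 1) = p - 1" "y - 1 + z = r - 1" by (simp_all add: pqr)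
    show ?thesis
      unfolding pair_product_def e pqr(2)[symmetric] M_def using ne by (simp add: divide_simps)
  qed
  have Z: "pair_product x y (z - 1) = (x - y) * (x - (z - 1)) * (y - (z - 1)) * (q * r * (p - 1)) / M"
  proof -
    have e: "x + (z - 1) = q - 1" "y + (z - 1) = r - 1" by (simp_all add: pqr)
    show ?thesis
      unfolding pair_product_def e pqr(1)[symmetric] M_def using ne by (simp add: divide_simps)
  qed
  have "(x + y + z) * ((x - y) * (x - z) * (y - z) * ((p - 1) * (q - 1) * (r - 1)))
    = x * ((x - 1 - y) * (x - 1 - z) * (y - z) * (p * q * (r - 1)))
    + y * ((x - (y - 1)) * (x - z) * (y - 1 - z) * (p * r * (q - 1)))
    + z * ((x - y) * (x - (z - 1)) * (y - (z - 1)) * (q * r * (p - 1)))"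
    unfolding pqr by algebra
  then show ?thesis
    unfolding P X Y Z by (simp only: times_divide_eq_right add_divide_distrib[symmetric])
qed

text \<open>
  Thrall's product formula for the number of shifted tableaux with three rows.
\<close>

definition thrall_product :: "nat \<Rightarrow> nat \<Rightarrow> nat \<Rightarrow> real" where
  "thrall_product a b c = fact (a + b + c) / (fact a * fact b * fact c) * pair_product a b c"

lemma thrall_product_rec:
  assumes "2 \<le> b" "2 \<le> a"
  shows "thrall_product a b c = thrall_product (a - 1) b c + thrall_product a (b - 1) c
    + (if 0 < c then thrall_product a b (c - 1) else 0)"
proof -
  define w :: real where "w = fact (a + b + c - 1) / (fact a * fact b * fact c)"
  have 1: "thrall_product a b c = w * (real (a + b + c) * pair_product a b c)"
    using assms fact_reduce[of "a + b + c", where 'a = real] by (simp add: thrall_product_def w_def)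
  have 2: "thrall_product (a - 1) b c = w * (a * pair_product (real a - 1) b c)"
    using assms fact_reduce[of "a", where 'a = real] by (simp add: thrall_product_def w_def of_nat_diff)
  have 3: "thrall_product a (b - 1) c = w * (b * pair_product a (real b - 1) c)"
    using assms fact_reduce[of "b", where 'a = real] by (simp add: thrall_product_def w_def of_nat_diff)
  have 4: "(if 0 < c then thrall_product a b (c - 1) else 0) = w * (c * pair_product a b (real c - 1))"
    using assms fact_reduce[of "c", where 'a = real] by (simp add: thrall_product_def w_def of_nat_diff)
  show ?thesis
    unfolding 1 2 3 4 using pair_product_rec[of a b c] assms
    by (simp add: distrib_left[symmetric])
qed

lemma thrall_product_refl: "thrall_product b b c = 0" "thrall_product a b b = 0"
  by (simp_all add: thrall_product_def pair_product_def)

text \<open>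
  Thrall's formula satisfies the corner recursion and vanishes when two consecutive nonempty rows have
  equal length, that is, on the shapes that result from shortening a row that must not be shortened. The shapes with at most one cell
  outside the first row are treated directly: with \<open>b = 0\<close> the product contains a division by zero, and
  the recursion at \<open>b = 1\<close> leads there.
\<close>

lemma num_tableaux_closed:
  assumes "b < a" "c < b \<or> b = 0 \<and> c = 0"
  shows "real (num_tableaux a b c) = (if b = 0 then 1 else thrall_product a b c)"
  using assms
proof (induction "a + b + c" arbitrary: a b c rule: less_induct)
  case less
  consider "b = 0" | "b = 1" | "b \<ge> 2" by linarith
  then show ?case
  proof cases
    case 1
    then show ?thesis
      using less num_tableaux_rec[of b a c] less.hyps[of "a - 1" 0 0] num_tableaux_0
      by (cases "a = 1") auto
  next
    case 2
    have one: "thrall_product a 1 0 = real a - 1" if "a \<ge> 1" for a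
      using that by (simp add: thrall_product_def pair_product_def divide_simps)
    have "real (num_tableaux a 0 0) = 1" using less 2 less.hyps[of a 0 0] by simp
    moreover have "real (num_tableaux (a - 1) 1 0) = thrall_product (a - 1) 1 0" if "2 < a"
      using less.hyps[of "a - 1" 1 0] that 2 less.prems by simp
    ultimately show ?thesis
      using less.prems 2 num_tableaux_rec[of b a c] one[of a] one[of "a - 1"]
      by (cases "2 < a") auto
  next
    case 3
    have "real (if b + 1 < a then num_tableaux (a - 1) b c else 0) = thrall_product (a - 1) b c"
      using less.hyps[of "a - 1" b c] less.prems 3 thrall_product_refl(1)[of b c]
      by (cases "b + 1 < a") (auto simp: not_less le_Suc_eq)
    moreover have "real (if c = 0 \<or> c + 1 < b then num_tableaux a (b - 1) c else 0)
        = thrall_product a (b - 1) c"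
      using less.hyps[of a "b - 1" c] less.prems 3 thrall_product_refl(2)[of a c]
      by (cases "c + 1 < b") (auto simp: not_less le_Suc_eq)
    moreover have "real (if 0 < c then num_tableaux a b (c - 1) else 0)
        = (if 0 < c then thrall_product a b (c - 1) else 0)"
      using less.hyps[of a b "c - 1"] less.prems 3 by auto
    ultimately show ?thesis
      using num_tableaux_rec[of b a c] thrall_product_rec[of b a c] less.prems 3 by simp
  qed
qed

lemma num_tableaux_step_two:
  assumes "n \<ge> 3"
  shows "real (num_tableaux (n + 2) n (n - 2)) = 2 * fact (3 * n) / (fact n * fact (n + 1) * fact (n + 2))"
proof -
  obtain r where n: "n = r + 3" using assms by (metis add.commute le_Suc_ex)
  define d :: real where "d = (real r + 4) * (real r + 3) * (real r + 2)"
  have "pair_product (real (n + 2)) (real n) (real (n - 2)) = 2 / d"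
    unfolding n d_def by (simp add: pair_product_def divide_simps) (simp add: algebra_simps)
  moreover have "fact (n + 1) = d * fact (n - 2)"
    unfolding n d_def by (simp add: eval_nat_numeral algebra_simps)
  moreover have "n + 2 + n + (n - 2) = 3 * n" using assms by simp
  moreover have "d > 0" by (simp add: d_def add_pos_pos)
  ultimately show ?thesis
    using assms num_tableaux_closed[of n "n + 2" "n - 2"] by (simp add: thrall_product_def mult_ac)
qed

section \<open>Comparison\<close>

theorem theorem3p1:
  fixes n :: nat
  assumes "n \<ge> 3"
  shows "card (alternating_avoiding (2 * n) [4, 3, 1, 2]) = card (SHSYT [n + 2, n, n - 2])"
proof -
  have "alternating_avoiding (2 * n) [4, 3, 1, 2] = avoiders n"
    unfolding alternating_avoiding_def avoiders_def contains_4312_iff ..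
  moreover have "real (card (avoiders n)) = real (card (SHSYT [n + 2, n, n - 2]))"
    using card_avoiders[of "n - 1"] H_closed[of "n - 1"] num_tableaux_step_two[OF assms] assms
    by (simp add: num_tableaux_def Suc_diff_Suc algebra_simps)
  ultimately show ?thesis by simp
qed

end
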